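(* For the one-dimensional forward Euler update of the discrete volume conservation law $$\overline J_i^{\Delta t}=\overline J_i-\frac{\Delta t}{\Delta\xi}\Big(\big(J\tfrac{\partial\xi}{\partial t}\big)_{i+\frac12}-\big(J\tfrac{\partial\xi}{\partial t}\big)_{i-\frac12}\Big),\qquad \big(J\tfrac{\partial\xi}{\partial t}\big)_{i\pm\frac12}=-\dot x_{i\pm\frac12}-\frac{\beta_J}{2}[\![J]\!]_{i\pm\frac12},$$ assume that $\overline J_i>0$ for all $i$. If $J_{i_\mu}>0$ for all $i,\mu$, then $\overline J_i^{\Delta t}>0$ holds (for all $i$) under the condition $$\Delta t\le\frac{\omega_1\,\Delta\xi}{\beta_J}.$$
   Context: The computational domain is divided uniformly into cells $I_i=[\xi_{i-1/2},\xi_{i+1/2}]$ of length $\Delta\xi>0$; values outside the domain are supplied by boundary conditions (ghost cells), and "for all $i$" includes these. $J=\partial x/\partial\xi$ is the Jacobian of the time-dependent map from computational to physical coordinates, $\overline J_i$ is its cell average over $I_i$ at the current time level, $\dot x_{i+1/2}\in\mathbb R$ are given mesh velocities at the nodes, and $\Delta t>0$ is the time step. $\omega_1,\dots,\omega_Q>0$ (with $\sum_\mu\omega_\mu=1$, $\omega_1=\omega_Q$, $Q=4$) are the Gauss–Lobatto quadrature weights, and $J_{i_\mu}$, $\mu=1,\dots,Q$, are reconstructed values of $J$ at the Gauss–Lobatto nodes of $I_i$ (the first and last nodes being the left and right endpoints). The reconstruction satisfies $\sum_{\mu=1}^Q\omega_\mu J_{i_\mu}=\overline J_i$. Interface traces: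 $J^-_{i+1/2}=J_{i_Q}$, $J^+_{i-1/2}=J_{i_1}$; jump $[\![J]\!]_{i+1/2}=J^+_{i+1/2}-J^-_{i+1/2}$. Furthermore $$\beta_J=\max_i\Big|\frac{\dot x_{i+1/2}}{J_{i+1/2}}\Big|,$$ where the maximum is over both one-sided values $J_{i+1/2}=J^{\pm}_{i+1/2}$ (if $\beta_J=0$ the time step condition is void). *)

theory Defs
  imports "HOL-Analysis.Analysis"
begin

text \<open>
  Conventions. The computational domain consists of the cells $I_1, \dots, I_N$; on each side it is
  extended by $g \ge 1$ ghost cells, so that data are given on $I_i$ for $1 - g \le i \le N + g$.
  Functions of the interface $\xi_{i+1/2}$ (the common face of $I_i$ and $I_{i+1}$) are indexed by
  the integer $i$. A reconstruction \<open>Jr\<close> assigns to a cell $i$ and to $\mu \in \{1,\dots,4\}$ the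
  value $J_{i_\mu}$ at the $\mu$-th Gauss--Lobatto node of $I_i$.
\<close>

definition cells :: "nat \<Rightarrow> nat \<Rightarrow> int set" where
  "cells N g = {1 - int g .. int N + int g}"

text \<open>Interfaces at which both one-sided traces exist.\<close>

definition interfaces :: "nat \<Rightarrow> nat \<Rightarrow> int set" where
  "interfaces N g = {i. i \<in> cells N g \<and> i + 1 \<in> cells N g}"

text \<open>
  Cells both of whose faces carry a numerical flux. They include $I_1, \dots, I_N$ and all ghost
  cells but the two outermost ones; for $g = 1$ they are exactly $I_1, \dots, I_N$.
\<close>

definition updated_cells :: "nat \<Rightarrow> nat \<Rightarrow> int set" where
  "updated_cells N g = {i. i \<in> interfaces N g \<and> i - 1 \<in> interfaces N g}"

text \<open>
  The four-point Gauss--Lobatto rule on the reference cell $[-1/2, 1/2]$. The weights are half of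
  the usual ones for $[-1, 1]$, so that they sum to 1.
\<close>

abbreviation gl_points :: nat where
  "gl_points \<equiv> 4"

definition gl_node :: "nat \<Rightarrow> real" where
  "gl_node \<mu> = (if \<mu> = 1 then - 1/2 else if \<mu> = 2 then - 1 / (2 * sqrt 5)
                else if \<mu> = 3 then 1 / (2 * sqrt 5) else 1/2)"

definition gl_weight :: "nat \<Rightarrow> real" where
  "gl_weight \<mu> = (if \<mu> = 1 \<or> \<mu> = gl_points then 1/12 else 5/12)"

lemma sum_gl_points: "(\<Sum>\<mu>=1..gl_points. f \<mu>) = f 1 + f 2 + f 3 + (f 4 :: real)"
  by (simp add: eval_nat_numeral)

lemma gl_weight_sum: "(\<Sum>\<mu>=1..gl_points. gl_weight \<mu>) = 1"
  unfolding sum_gl_points by (simp add: gl_weight_def)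

text \<open>Exactness up to degree $2 \cdot 4 - 3 = 5$, which characterizes this rule among the four-point rules
  using both endpoints.\<close>

lemma gl_exact:
  assumes "k \<le> 5"
  shows "((\<lambda>x. x ^ k) has_integral (\<Sum>\<mu>=1..gl_points. gl_weight \<mu> * gl_node \<mu> ^ k)) {-1/2..1/2::real}"
proof -
  have "sqrt 5 ^ 4 = (25::real)"
    using power_mult[of "sqrt 5" 2 2] by simp
  have "((\<lambda>x::real. x ^ k) has_integral
          ((1/2) ^ Suc k / real (Suc k) - (-1/2) ^ Suc k / real (Suc k))) {-1/2..1/2}"
  proof (rule fundamental_theorem_of_calculus)
    fix x :: real
    show "((\<lambda>x. x ^ Suc k / real (Suc k)) has_vector_derivative x ^ k) (at x within {-1/2..1/2})"
      unfolding has_real_derivative_iff_has_vector_derivative[symmetric]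
      by (rule derivative_eq_intros refl | simp)+
  qed simp
  moreover have "k \<in> {0, 1, 2, 3, 4, 5}"
    using assms by auto
  then have "(1/2) ^ Suc k / real (Suc k) - (-1/2) ^ Suc k / real (Suc k)
      = (\<Sum>\<mu>=1..gl_points. gl_weight \<mu> * gl_node \<mu> ^ k)"
    unfolding sum_gl_points
    using \<open>sqrt 5 ^ 4 = 25\<close>
    by (auto simp: gl_weight_def gl_node_def power_divide power_mult_distrib field_simps)
  ultimately show ?thesis
    by simp
qed

text \<open>$J^-_{i+1/2}$, $J^+_{i+1/2}$ and $[\![J]\!]_{i+1/2}$.\<close>

definition trace_minus :: "(int \<Rightarrow> nat \<Rightarrow> real) \<Rightarrow> int \<Rightarrow> real" where
  "trace_minus Jr i = Jr i gl_points"

definition trace_plus :: "(int \<Rightarrow> nat \<Rightarrow> real) \<Rightarrow> int \<Rightarrow> real" where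
  "trace_plus Jr i = Jr (i + 1) 1"

definition jump :: "(int \<Rightarrow> nat \<Rightarrow> real) \<Rightarrow> int \<Rightarrow> real" where
  "jump Jr i = trace_plus Jr i - trace_minus Jr i"

definition beta_J :: "nat \<Rightarrow> nat \<Rightarrow> (int \<Rightarrow> nat \<Rightarrow> real) \<Rightarrow> (int \<Rightarrow> real) \<Rightarrow> real" where
  "beta_J N g Jr xdot =
     Max ((\<lambda>i. \<bar>xdot i / trace_minus Jr i\<bar>) ` interfaces N g
          \<union> (\<lambda>i. \<bar>xdot i / trace_plus Jr i\<bar>) ` interfaces N g)"

text \<open>The numerical flux $(J\,\partial\xi/\partial t)_{i+1/2}$.\<close>

definition vcl_flux :: "nat \<Rightarrow> nat \<Rightarrow> (int \<Rightarrow> nat \<Rightarrow> real) \<Rightarrow> (int \<Rightarrow> real) \<Rightarrow> int \<Rightarrow> real" where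
  "vcl_flux N g Jr xdot i = - xdot i - beta_J N g Jr xdot / 2 * jump Jr i"

definition vcl_euler_step ::
  "nat \<Rightarrow> nat \<Rightarrow> real \<Rightarrow> real \<Rightarrow> (int \<Rightarrow> real) \<Rightarrow> (int \<Rightarrow> nat \<Rightarrow> real) \<Rightarrow> (int \<Rightarrow> real) \<Rightarrow> int \<Rightarrow> real" where
  "vcl_euler_step N g dt d\<xi> Jbar Jr xdot i =
     Jbar i - dt / d\<xi> * (vcl_flux N g Jr xdot i - vcl_flux N g Jr xdot (i - 1))"

end

theory Submission imports Defs begin

text \<open>
  By the choice of \<open>\<beta>\<^sub>J\<close> the mesh velocity at a face is at most \<open>\<beta>\<^sub>J\<close> times the mean of the two
  traces there, so the dissipative flux removes from a cell at most \<open>\<beta>\<^sub>J\<close> times the cell's own trace.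
  Under the time step condition the loss is at most \<open>\<omega>\<^sub>1 (J\<^sub>1 + J\<^sub>4)\<close>, and the two interior nodes keep
  the average positive.
\<close>

lemma finite_interfaces: "finite (interfaces N g)"
  by (rule finite_subset[of _ "cells N g"]) (auto simp: interfaces_def cells_def)

text \<open>The maximum in \<open>beta_J\<close> runs over both one-sided quotients at each face, so
  the same speed is controlled by either trace.\<close>

lemma abs_xdot_le_beta_J:
  assumes "i \<in> interfaces N g"
  shows "trace_minus Jr i > 0 \<Longrightarrow> \<bar>xdot i\<bar> \<le> beta_J N g Jr xdot * trace_minus Jr i"
    and "trace_plus Jr i > 0 \<Longrightarrow> \<bar>xdot i\<bar> \<le> beta_J N g Jr xdot * trace_plus Jr i"
proof -
  have "\<bar>xdot i / trace_minus Jr i\<bar> \<le> beta_J N g Jr xdot"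
    and "\<bar>xdot i / trace_plus Jr i\<bar> \<le> beta_J N g Jr xdot"
    unfolding beta_J_def using assms by (auto intro!: Max_ge simp: finite_interfaces)
  then show "trace_minus Jr i > 0 \<Longrightarrow> \<bar>xdot i\<bar> \<le> beta_J N g Jr xdot * trace_minus Jr i"
    and "trace_plus Jr i > 0 \<Longrightarrow> \<bar>xdot i\<bar> \<le> beta_J N g Jr xdot * trace_plus Jr i"
    by (simp_all add: abs_divide pos_divide_le_eq)
qed

text \<open>Averaging the two bounds on the mesh speed gives \<beta>/2 times the sum of the traces.
  The jump term cancels the half of one trace and doubles that of the other.\<close>

lemma vcl_flux_bounds:
  assumes "i \<in> interfaces N g" "trace_minus Jr i > 0" "trace_plus Jr i > 0"
  shows "vcl_flux N g Jr xdot i \<le> beta_J N g Jr xdot * trace_minus Jr i"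
    and "- (beta_J N g Jr xdot * trace_plus Jr i) \<le> vcl_flux N g Jr xdot i"
  using abs_xdot_le_beta_J[OF assms(1), of Jr xdot] assms(2,3)
  by (auto simp: vcl_flux_def jump_def abs_le_iff field_simps)

theorem theorem3p2:
  fixes N g :: nat
    and dt d\<xi> :: real
    and Jbar xdot :: "int \<Rightarrow> real"
    and Jr :: "int \<Rightarrow> nat \<Rightarrow> real"
  assumes "N \<ge> 1" and "g \<ge> 1"
    and "d\<xi> > 0" and "dt > 0"
    and reconstruction:
      "\<And>i. i \<in> cells N g \<Longrightarrow> (\<Sum>\<mu>=1..gl_points. gl_weight \<mu> * Jr i \<mu>) = Jbar i"
    and "\<And>i. i \<in> cells N g \<Longrightarrow> Jbar i > 0"
    and "\<And>i \<mu>. i \<in> cells N g \<Longrightarrow> \<mu> \<in> {1..gl_points} \<Longrightarrow> Jr i \<mu> > 0"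
    and time_step:
      "beta_J N g Jr xdot \<noteq> 0 \<Longrightarrow> dt \<le> gl_weight 1 * d\<xi> / beta_J N g Jr xdot"
  shows "\<forall>i \<in> updated_cells N g. vcl_euler_step N g dt d\<xi> Jbar Jr xdot i > 0"
proof
  fix i
  assume "i \<in> updated_cells N g"
  then have faces: "i \<in> interfaces N g" "i - 1 \<in> interfaces N g"
    and cells: "i - 1 \<in> cells N g" "i \<in> cells N g" "i + 1 \<in> cells N g"
    by (auto simp: updated_cells_def interfaces_def)
  define \<beta> where "\<beta> = beta_J N g Jr xdot"
  have pos: "Jr j \<mu> > 0" if "j \<in> {i - 1, i, i + 1}" "\<mu> \<in> {1, 2, 3, 4}" for j \<mu>
    using assms(7)[of j \<mu>] cells that by auto
  have right: "vcl_flux N g Jr xdot i \<le> \<beta> * Jr i 4"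
    using vcl_flux_bounds(1)[OF faces(1), of Jr xdot] pos
    by (simp add: \<beta>_def trace_minus_def trace_plus_def)
  \<comment> \<open>The left face has index \<open>i - 1\<close>, and its plus trace is node 1 of
    cell \<open>i\<close>; so both flux bounds involve end nodes of cell \<open>i\<close>
    only.\<close>
  have left: "- (\<beta> * Jr i 1) \<le> vcl_flux N g Jr xdot (i - 1)"
    using vcl_flux_bounds(2)[OF faces(2), of Jr xdot] pos
    by (simp add: \<beta>_def trace_minus_def trace_plus_def)
  \<comment> \<open>The sign of \<beta> is read off from an absolute value bounded by \<beta> times
    a positive trace.\<close>
  have "0 \<le> \<beta> * Jr i 4"
    using abs_xdot_le_beta_J(1)[OF faces(1), of Jr xdot] pos[of i 4]
    by (simp add: \<beta>_def trace_minus_def)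
  then have "\<beta> \<ge> 0"
    using pos[of i 4] by (simp add: zero_le_mult_iff)
  \<comment> \<open>For \<beta> = 0 the time step condition is void, but the left side vanishes and
    the weight is positive.\<close>
  then have cfl: "dt / d\<xi> * \<beta> \<le> gl_weight 1"
    using time_step \<open>d\<xi> > 0\<close>
    by (cases "\<beta> = 0") (auto simp: \<beta>_def gl_weight_def field_simps)
  have "dt / d\<xi> * (vcl_flux N g Jr xdot i - vcl_flux N g Jr xdot (i - 1))
      \<le> dt / d\<xi> * (\<beta> * (Jr i 1 + Jr i 4))"
    using left right \<open>d\<xi> > 0\<close> \<open>dt > 0\<close>
    by (intro mult_left_mono) (auto simp: distrib_left)
  also have "\<dots> \<le> gl_weight 1 * (Jr i 1 + Jr i 4)"
    using mult_right_mono[OF cfl, of "Jr i 1 + Jr i 4"] pos[of i 1] pos[of i 4]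
    by (simp add: mult.assoc)
  \<comment> \<open>Both end nodes have the same weight, so their terms cancel and the interior
    terms give strictness.\<close>
  also have "\<dots> < Jbar i"
    unfolding reconstruction[OF cells(2), symmetric] sum_gl_points
    using pos[of i 2] pos[of i 3] by (simp add: gl_weight_def)
  finally show "vcl_euler_step N g dt d\<xi> Jbar Jr xdot i > 0"
    by (simp add: vcl_euler_step_def)
qed

end
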